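(* For all integers $n\ge 0$, $$\overline{R_{4,9}}(12n+3)\equiv 0 \pmod 8,\qquad \overline{R_{4,9}}(12n+7)\equiv 0 \pmod 8,\qquad \overline{R_{4,9}}(12n+11)\equiv 0 \pmod 8.$$
   Context: An overpartition of a nonnegative integer $n$ is a partition of $n$ (a non-increasing sequence of positive integers summing to $n$) in which the first occurrence of each part size may be overlined. For coprime positive integers $\ell,\mu$, $\overline{R_{\ell,\mu}}(n)$ denotes the number of overpartitions of $n$ in which no part is divisible by $\ell$ or by $\mu$ (with $\overline{R_{\ell,\mu}}(0)=1$). Its generating function, for $|q|<1$, is $$\sum_{n\ge 0}\overline{R_{\ell,\mu}}(n)q^n=\prod_{n=1}^{\infty}\frac{(1+q^{n})(1-q^{\ell n})(1-q^{\mu n})(1+q^{\ell\mu n})}{(1-q^{n})(1+q^{\ell n})(1+q^{\mu n})(1-q^{\ell\mu n})}.$$ The claim concerns $(\ell,\mu)=(4,9)$. *)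

theory Defs
  imports "HOL-Number_Theory.Cong"
begin

(* A part is a pair (size, overlined?). The last conjunct lets only the first
   occurrence of a size carry an overline. *)
definition overpartition :: "nat \<Rightarrow> (nat \<times> bool) list \<Rightarrow> bool" where
  "overpartition n xs \<longleftrightarrow>
     sorted_wrt (\<ge>) (map fst xs) \<and>
     (\<forall>p \<in> set xs. 0 < fst p) \<and>
     sum_list (map fst xs) = n \<and>
     (\<forall>i < length xs. snd (xs ! i) \<longrightarrow> (\<forall>j < i. fst (xs ! j) \<noteq> fst (xs ! i)))"

definition R_bar :: "nat \<Rightarrow> nat \<Rightarrow> nat \<Rightarrow> nat" where
  "R_bar l m n =
     card {xs. overpartition n xs \<and> (\<forall>p \<in> set xs. \<not> l dvd fst p \<and> \<not> m dvd fst p)}"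

(* The set counted by R_bar is finite, so card does not default to 0. *)
lemma finite_overpartitions: "finite {xs. overpartition n xs}"
proof (rule finite_subset)
  show "{xs. overpartition n xs} \<subseteq> {xs. set xs \<subseteq> {..n} \<times> UNIV \<and> length xs \<le> n}"
  proof
    fix xs assume "xs \<in> {xs. overpartition n xs}"
    then have pos: "\<forall>p \<in> set xs. 0 < fst p" and s: "sum_list (map fst xs) = n"
      by (auto simp: overpartition_def)
    have "length xs \<le> sum_list (map fst xs)"
      using pos by (induction xs) auto
    moreover have "fst p \<le> sum_list (map fst xs)" if "p \<in> set xs" for p
      using that by (auto intro!: member_le_sum_list)
    ultimately show "xs \<in> {xs. set xs \<subseteq> {..n} \<times> UNIV \<and> length xs \<le> n}"
      using s by fastforce
  qed
  show "finite {xs. set xs \<subseteq> {..n} \<times> (UNIV :: bool set) \<and> length xs \<le> n}"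
    by (intro finite_lists_length_le) auto
qed

lemma R_bar_0: "R_bar l m 0 = 1"
proof -
  have "{xs. overpartition 0 xs \<and> (\<forall>p \<in> set xs. \<not> l dvd fst p \<and> \<not> m dvd fst p)} = {[]}"
    by (auto simp: overpartition_def) (metis list.set_intros(1) list.exhaust fst_conv surj_pair not_gr0)
  then show ?thesis by (simp add: R_bar_def)
qed

end

theory Submission
  imports Defs
begin

text \<open>
  The congruence holds for every \<open>N\<close> with \<open>N mod 4 = 3\<close>; these are the three progressions
  modulo 12 taken together.  The proof is a count.

  A partition with \<open>k\<close> distinct part sizes carries \<open>2 ^ k\<close> choices of overlines, so modulo 8 only
  partitions with one or two sizes matter: the number of overpartitions is
  \<open>2 N\<^sub>1 + 4 N\<^sub>2\<close> modulo 8, where \<open>N\<^sub>k\<close> counts the partitions of \<open>N\<close> into allowed parts of exactly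
  \<open>k\<close> sizes (\<open>overpartition_count_mod_8\<close>).  It remains to see that 4 divides \<open>N\<^sub>1 + 2 N\<^sub>2\<close>.

  Here \<open>N\<^sub>1\<close> is the number of allowed divisors of \<open>N\<close>, and \<open>2 N\<^sub>2\<close> is the number of solutions of
  \<open>a r + b s = N\<close> in positive integers with \<open>a\<close>, \<open>b\<close> allowed and \<open>a \<noteq> b\<close>.  The solutions with
  \<open>a = b = d\<close> number \<open>N / d - 1\<close> for each allowed divisor \<open>d\<close>.  If \<open>Q\<close> is the number of all
  solutions, then
  \[ N_1 + 2 N_2 = Q + 2 N_1 - \sum_d N / d , \]
  and each of the three terms on the right is a multiple of 4:
  \<^item> \<open>Q\<close>, since exactly one of the products \<open>a r\<close>, \<open>b s\<close> is even, the two can be exchanged, and in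
    the even product a factor 2 can be moved between the part and its multiplicity, because \<open>a\<close> may
    be even but not divisible by 4 (\<open>four_dvd_card_two_part_solutions\<close>);
  \<^item> \<open>2 N\<^sub>1\<close> and the sum, by pairing the divisors: \<open>d\<close> with \<open>3 d\<close> if 3 divides \<open>N\<close>, where
    \<open>9\<close> being forbidden leaves just these two classes, and \<open>d\<close> with \<open>N / d\<close> otherwise, where one of
    them is 1 and the other 3 modulo 4 (\<open>allowed_divisors_paired\<close>).
\<close>

section \<open>Choosing the overlines\<close>

definition overlines_first :: "(nat \<times> bool) list \<Rightarrow> bool" where
  "overlines_first xs \<longleftrightarrow>
     (\<forall>i < length xs. snd (xs ! i) \<longrightarrow> (\<forall>j < i. fst (xs ! j) \<noteq> fst (xs ! i)))"

definition partitions_into :: "(nat \<Rightarrow> bool) \<Rightarrow> nat \<Rightarrow> nat list set" where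
  "partitions_into P n =
     {p. sorted_wrt (\<ge>) p \<and> (\<forall>x \<in> set p. 0 < x \<and> P x) \<and> sum_list p = n}"

lemma overlines_first_snoc:
  "overlines_first (xs @ [x]) \<longleftrightarrow>
     overlines_first xs \<and> (snd x \<longrightarrow> fst x \<notin> set (map fst xs))"
proof -
  have "fst x \<notin> set (map fst xs) \<longleftrightarrow> (\<forall>j < length xs. fst (xs ! j) \<noteq> fst x)"
    by (metis in_set_conv_nth length_map nth_map)
  then show ?thesis
    by (auto simp: overlines_first_def nth_append less_Suc_eq all_conj_distrib)
qed

text \<open>
  Reading the list from the left, each new size doubles the number of choices and a repeated size
  leaves no choice.
\<close>

lemma card_overlinings:
  "finite {xs. map fst xs = p \<and> overlines_first xs} \<and>
   card {xs. map fst xs = p \<and> overlines_first xs} = 2 ^ card (set p)"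
proof (induction p rule: rev_induct)
  case Nil
  have "{xs. map fst xs = [] \<and> overlines_first xs} = {[]}"
    by (auto simp: overlines_first_def)
  then show ?case by simp
next
  case (snoc a p)
  let ?F = "{xs. map fst xs = p \<and> overlines_first xs}"
  let ?B = "if a \<in> set p then {False} else UNIV"
  let ?f = "\<lambda>(xs, o'). xs @ [(a, o' :: bool)]"
  have eq: "{xs. map fst xs = p @ [a] \<and> overlines_first xs} = ?f ` (?F \<times> ?B)"
  proof (intro equalityI subsetI)
    fix xs assume xs: "xs \<in> {xs. map fst xs = p @ [a] \<and> overlines_first xs}"
    then obtain ys y where "xs = ys @ [y]"
      by (cases xs rule: rev_cases) auto
    with xs show "xs \<in> ?f ` (?F \<times> ?B)"
      by (cases y) (auto simp: overlines_first_snoc image_iff)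
  next
    fix xs assume "xs \<in> ?f ` (?F \<times> ?B)"
    then show "xs \<in> {xs. map fst xs = p @ [a] \<and> overlines_first xs}"
      by (auto simp: overlines_first_snoc split: if_splits)
  qed
  have "inj_on ?f (?F \<times> ?B)"
    by (auto simp: inj_on_def)
  then have "card (?f ` (?F \<times> ?B)) = card ?F * card ?B"
    by (simp add: card_image card_cartesian_product)
  moreover have "card ?F * card ?B = 2 ^ card (set (p @ [a]))"
    using snoc.IH by (auto simp: insert_absorb)
  ultimately show ?case
    using snoc.IH by (auto simp: eq)
qed

lemma finite_partitions_into: "finite (partitions_into P n)"
proof (rule finite_subset)
  show "partitions_into P n \<subseteq> map fst ` {xs. overpartition n xs}"
  proof
    fix p assume p: "p \<in> partitions_into P n"
    have "overpartition n (map (\<lambda>x. (x, False)) p)"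
      using p by (auto simp: overpartition_def partitions_into_def comp_def)
    then show "p \<in> map fst ` {xs. overpartition n xs}"
      by (auto simp: image_iff comp_def intro!: exI[of _ "map (\<lambda>x. (x, False)) p"])
  qed
qed (simp add: finite_overpartitions)

lemma card_overpartitions_into:
  "card {xs. overpartition n xs \<and> (\<forall>x \<in> set xs. P (fst x))} =
     (\<Sum>p \<in> partitions_into P n. 2 ^ card (set p))"
proof -
  let ?F = "\<lambda>p. {xs. map fst xs = p \<and> overlines_first xs}"
  have "{xs. overpartition n xs \<and> (\<forall>x \<in> set xs. P (fst x))} =
        (\<Union>p \<in> partitions_into P n. ?F p)"
    by (auto simp: overpartition_def partitions_into_def overlines_first_def) fastforce+
  moreover have "card (\<Union>p \<in> partitions_into P n. ?F p) =
                 (\<Sum>p \<in> partitions_into P n. card (?F p))"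
    by (rule card_UN_disjoint) (auto simp: card_overlinings finite_partitions_into)
  ultimately show ?thesis
    by (simp add: card_overlinings)
qed

section \<open>Partitions with one or two part sizes\<close>

definition allowed_divisors :: "(nat \<Rightarrow> bool) \<Rightarrow> nat \<Rightarrow> nat set" where
  "allowed_divisors P n = {d. d dvd n \<and> P d}"

definition two_part_solutions :: "(nat \<Rightarrow> bool) \<Rightarrow> nat \<Rightarrow> (nat \<times> nat \<times> nat \<times> nat) set" where
  "two_part_solutions P n =
     {(a, r, b, s). P a \<and> P b \<and> 0 < a \<and> 0 < r \<and> 0 < b \<and> 0 < s \<and> a * r + b * s = n}"

lemma finite_allowed_divisors: "0 < n \<Longrightarrow> finite (allowed_divisors P n)"
  by (rule finite_subset[of _ "{..n}"]) (auto simp: allowed_divisors_def dvd_imp_le)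

lemma finite_two_part_solutions: "finite (two_part_solutions P n)"
proof (rule finite_subset)
  show "two_part_solutions P n \<subseteq> {..n} \<times> {..n} \<times> {..n} \<times> {..n}"
  proof
    fix x assume "x \<in> two_part_solutions P n"
    then obtain a r b s where x: "x = (a, r, b, s)"
      and pos: "0 < a" "0 < r" "0 < b" "0 < s" and n: "a * r + b * s = n"
      by (auto simp: two_part_solutions_def)
    have "a \<le> a * r" "r \<le> a * r" "b \<le> b * s" "s \<le> b * s"
      using pos by auto
    with n have "a \<le> n" "r \<le> n" "b \<le> n" "s \<le> n"
      by linarith+
    then show "x \<in> {..n} \<times> {..n} \<times> {..n} \<times> {..n}"
      by (simp add: x)
  qed
qed simp

lemma sorted_wrt_replicate_ge: "sorted_wrt (\<ge>) (replicate k (a :: nat))"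
  by (induction k) auto

lemma sorted_two_values_eq_replicate:
  fixes a b :: nat
  assumes "sorted_wrt (\<ge>) p" "set p \<subseteq> {a, b}" "b < a"
  shows "p = replicate (count_list p a) a @ replicate (count_list p b) b"
  using assms
proof (induction p)
  case (Cons x p)
  show ?case
  proof (cases "x = a")
    case True
    with Cons show ?thesis by auto
  next
    case False
    with Cons.prems have x: "x = b" and "a \<notin> set p" by auto
    then have "count_list p a = 0" by (simp add: count_list_0_iff)
    with Cons x show ?thesis by auto
  qed
qed simp

lemma card_partitions_one_size:
  assumes "0 < n"
  shows "card {p \<in> partitions_into P n. card (set p) = 1} = card (allowed_divisors P n)"
proof -
  let ?f = "\<lambda>d. replicate (n div d) d"
  have "{p \<in> partitions_into P n. card (set p) = 1} = ?f ` allowed_divisors P n"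
  proof (intro equalityI subsetI)
    fix p assume p: "p \<in> {p \<in> partitions_into P n. card (set p) = 1}"
    then obtain d where d: "set p = {d}" by (auto simp: card_1_singleton_iff)
    then have rep: "p = replicate (length p) d"
      by (metis replicate_length_same singletonD)
    have "sum_list p = length p * d"
      by (subst rep) (simp add: sum_list_replicate)
    then have "n = length p * d" "0 < d" "P d"
      using p d by (auto simp: partitions_into_def)
    then show "p \<in> ?f ` allowed_divisors P n"
      using rep by (auto simp: allowed_divisors_def intro!: image_eqI[of _ _ d])
  next
    fix p assume "p \<in> ?f ` allowed_divisors P n"
    then obtain d where d: "d dvd n" "P d" "p = ?f d"
      by (auto simp: allowed_divisors_def)
    with assms have "0 < d" "0 < n div d"
      by (auto simp: div_greater_zero_iff dvd_imp_le intro: dvd_pos_nat)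
    with d show "p \<in> {p \<in> partitions_into P n. card (set p) = 1}"
      by (auto simp: partitions_into_def sum_list_replicate sorted_wrt_replicate_ge)
  qed
  moreover have "inj_on ?f (allowed_divisors P n)"
  proof (rule inj_onI)
    fix d e assume "d \<in> allowed_divisors P n" "e \<in> allowed_divisors P n" "?f d = ?f e"
    moreover from this assms have "n div d \<noteq> 0"
      by (auto simp: allowed_divisors_def dvd_div_eq_0_iff)
    ultimately show "d = e"
      by (metis replicate_eq_replicate)
  qed
  ultimately show ?thesis by (simp add: card_image)
qed

lemma card_partitions_two_sizes:
  "card {p \<in> partitions_into P n. card (set p) = 2} =
     card {(a, r, b, s) \<in> two_part_solutions P n. b < a}"
proof -
  let ?A = "{(a, r, b, s) \<in> two_part_solutions P n. b < a}"
  let ?f = "\<lambda>(a, r, b, s). replicate r a @ replicate s (b :: nat)"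
  have "{p \<in> partitions_into P n. card (set p) = 2} = ?f ` ?A"
  proof (intro equalityI subsetI)
    fix p assume p: "p \<in> {p \<in> partitions_into P n. card (set p) = 2}"
    then obtain a b where ab: "set p = {a, b}" "b < a"
      by (auto simp: card_2_iff) (metis insert_commute linorder_neqE_nat)
    let ?r = "count_list p a" and ?s = "count_list p b"
    have rep: "p = replicate ?r a @ replicate ?s b"
      using p ab by (intro sorted_two_values_eq_replicate) (auto simp: partitions_into_def)
    have "?r \<noteq> 0" "?s \<noteq> 0"
      using ab by (auto simp: count_list_0_iff)
    moreover have "sum_list p = a * ?r + b * ?s"
      by (subst rep) (simp add: sum_list_replicate mult.commute)
    ultimately have "(a, ?r, b, ?s) \<in> ?A"
      using p ab by (auto simp: partitions_into_def two_part_solutions_def)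
    then show "p \<in> ?f ` ?A"
      using rep by (force intro: image_eqI[of _ _ "(a, ?r, b, ?s)"])
  next
    fix p assume "p \<in> ?f ` ?A"
    then show "p \<in> {p \<in> partitions_into P n. card (set p) = 2}"
      by (auto simp: partitions_into_def two_part_solutions_def sum_list_replicate
            sorted_wrt_append sorted_wrt_replicate_ge mult.commute)
  qed
  moreover have "inj_on ?f ?A"
  proof (rule inj_onI)
    fix x y assume "x \<in> ?A" "y \<in> ?A" "?f x = ?f y"
    then obtain a r b s a' r' b' s' where xy: "x = (a, r, b, s)" "y = (a', r', b', s')"
      and *: "(a, r, b, s) \<in> two_part_solutions P n" "b < a"
      "(a', r', b', s') \<in> two_part_solutions P n" "b' < a'"
      and eq: "replicate r a @ replicate s b = replicate r' a' @ replicate s' b'"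
      by auto
    have "set (replicate r a @ replicate s b) = {a, b}"
      "set (replicate r' a' @ replicate s' b') = {a', b'}"
      using * by (auto simp: two_part_solutions_def)
    then have "{a, b} = {a', b'}"
      using eq by simp
    then have ab: "a = a'" "b = b'"
      using * by (auto simp: doubleton_eq_iff)
    have "count_list (replicate r a @ replicate s b) x =
          count_list (replicate r' a' @ replicate s' b') x" for x
      by (simp add: eq)
    from this[of a] this[of b] have "r = r'" "s = s'"
      using ab * by (auto simp: count_list_eq_length_filter filter_replicate split: if_splits)
    with ab show "x = y" by (simp add: xy)
  qed
  ultimately show ?thesis by (simp add: card_image)
qed

text \<open>
  Each partition with at least three sizes contributes a multiple of \<open>2 ^ 3\<close>, and \<open>n > 0\<close> excludes
  the empty partition.  Ordering the two sizes as \<open>b < a\<close> counts each partition with two sizes once.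
\<close>

lemma overpartition_count_mod_8:
  assumes "0 < n"
  shows "[card {xs. overpartition n xs \<and> (\<forall>x \<in> set xs. P (fst x))} =
          2 * card (allowed_divisors P n) +
          4 * card {(a, r, b, s) \<in> two_part_solutions P n. b < a}] (mod 8)"
proof -
  let ?L = "partitions_into P n"
  let ?A = "{p \<in> ?L. card (set p) = 1}" and ?B = "{p \<in> ?L. card (set p) = 2}"
    and ?C = "{p \<in> ?L. 3 \<le> card (set p)}"
  let ?w = "\<lambda>p. 2 ^ card (set p) :: nat"
  have "card (set p) = 1 \<or> card (set p) = 2 \<or> 3 \<le> card (set p)" if "p \<in> ?L" for p
  proof -
    have "card (set p) \<noteq> 0"
      using that assms by (auto simp: partitions_into_def)
    then show ?thesis by linarith
  qed
  then have split: "?L = ?A \<union> (?B \<union> ?C)"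
    by blast
  have "sum ?w ?L = sum ?w ?A + (sum ?w ?B + sum ?w ?C)"
  proof -
    have "sum ?w ?L = sum ?w (?A \<union> (?B \<union> ?C))"
      using split by (rule arg_cong)
    also have "\<dots> = sum ?w ?A + sum ?w (?B \<union> ?C)"
      by (rule sum.union_disjoint) (auto simp: finite_partitions_into)
    also have "sum ?w (?B \<union> ?C) = sum ?w ?B + sum ?w ?C"
      by (rule sum.union_disjoint) (auto simp: finite_partitions_into)
    finally show ?thesis .
  qed
  moreover have "sum ?w ?A = 2 * card ?A" "sum ?w ?B = 4 * card ?B"
    by simp_all
  ultimately have total: "sum ?w ?L = 2 * card ?A + 4 * card ?B + sum ?w ?C"
    by linarith
  have "8 dvd sum ?w ?C"
  proof (rule dvd_sum)
    fix p assume "p \<in> ?C"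
    then have "(2::nat) ^ 3 dvd 2 ^ card (set p)"
      by (intro le_imp_power_dvd) simp
    then show "8 dvd ?w p" by simp
  qed
  then obtain k where k: "sum ?w ?C = 8 * k" ..
  have "[sum ?w ?L = 2 * card ?A + 4 * card ?B] (mod 8)"
    by (simp only: total k cong_def mod_mult_self2)
  then show ?thesis
    by (simp only: card_overpartitions_into[of n P] card_partitions_two_sizes[of P n]
          card_partitions_one_size[OF assms, of P])
qed

section \<open>Solutions with equal parts\<close>

lemma card_two_part_solutions_swap:
  "card {(a, r, b, s) \<in> two_part_solutions P n. R a r b s} =
   card {(a, r, b, s) \<in> two_part_solutions P n. R b s a r}"
proof (rule bij_betw_same_card)
  show "bij_betw (\<lambda>(a, r, b, s). (b, s, a, r))
          {(a, r, b, s) \<in> two_part_solutions P n. R a r b s}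
          {(a, r, b, s) \<in> two_part_solutions P n. R b s a r}"
    by (rule bij_betw_byWitness[of _ "\<lambda>(a, r, b, s). (b, s, a, r)"])
       (auto simp: two_part_solutions_def add.commute)
qed

text \<open>
  With \<open>a = b = d\<close> the equation reads \<open>r + s = n / d\<close>, which has \<open>n / d - 1\<close> positive solutions.
  Adding the number of divisors keeps the identity free of subtraction.
\<close>

lemma card_two_part_solutions_equal:
  assumes "0 < n"
  shows "card {(a, r, b, s) \<in> two_part_solutions P n. a = b} + card (allowed_divisors P n) =
         (\<Sum>d \<in> allowed_divisors P n. n div d)"
proof -
  let ?D = "allowed_divisors P n"
  let ?f = "\<lambda>(d, r). (d, r, d, n div d - r)"
  have "{(a, r, b, s) \<in> two_part_solutions P n. a = b} =
        ?f ` (SIGMA d:?D. {1..<n div d})"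
  proof (intro equalityI subsetI)
    fix x assume "x \<in> {(a, r, b, s) \<in> two_part_solutions P n. a = b}"
    then obtain d r s where x: "x = (d, r, d, s)" "P d" "0 < d" "0 < r" "0 < s"
      and n: "n = d * (r + s)"
      by (auto simp: two_part_solutions_def distrib_left)
    then have "(d, r) \<in> (SIGMA d:?D. {1..<n div d})" "x = ?f (d, r)"
      by (auto simp: allowed_divisors_def)
    then show "x \<in> ?f ` (SIGMA d:?D. {1..<n div d})" by blast
  next
    fix x assume "x \<in> ?f ` (SIGMA d:?D. {1..<n div d})"
    then obtain d r where x: "x = ?f (d, r)" "d dvd n" "P d" "1 \<le> r" "r < n div d"
      by (auto simp: allowed_divisors_def)
    then have "d * r + d * (n div d - r) = n"
      by (simp flip: distrib_left)
    moreover have "0 < d" using x assms by (auto intro: dvd_pos_nat)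
    ultimately show "x \<in> {(a, r, b, s) \<in> two_part_solutions P n. a = b}"
      using x by (auto simp: two_part_solutions_def)
  qed
  moreover have "inj_on ?f (SIGMA d:?D. {1..<n div d})"
    by (auto simp: inj_on_def)
  ultimately have "card {(a, r, b, s) \<in> two_part_solutions P n. a = b} =
                   (\<Sum>d \<in> ?D. n div d - 1)"
    using assms by (simp add: card_image finite_allowed_divisors)
  moreover have "(\<Sum>d \<in> ?D. n div d - 1) + card ?D = (\<Sum>d \<in> ?D. (n div d - 1) + 1)"
    by (simp only: sum.distrib card_eq_sum)
  moreover have "\<dots> = (\<Sum>d \<in> ?D. n div d)"
  proof (rule sum.cong)
    fix d assume "d \<in> ?D"
    then have "0 < n div d"
      using assms
      by (auto simp: allowed_divisors_def div_greater_zero_iff dvd_imp_le intro: dvd_pos_nat)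
    then show "n div d - 1 + 1 = n div d" by simp
  qed simp
  ultimately show ?thesis by simp
qed

text \<open>
  Sorting all solutions by \<open>a < b\<close>, \<open>a > b\<close> and \<open>a = b\<close>; the first two classes are equinumerous.
\<close>

lemma card_two_part_solutions_by_order:
  assumes "0 < n"
  shows "2 * card {(a, r, b, s) \<in> two_part_solutions P n. b < a} +
           (\<Sum>d \<in> allowed_divisors P n. n div d) =
         card (two_part_solutions P n) + card (allowed_divisors P n)"
proof -
  let ?Q = "two_part_solutions P n"
  let ?G = "{(a, r, b, s) \<in> ?Q. b < a}" and ?L = "{(a, r, b, s) \<in> ?Q. a < b}"
    and ?E = "{(a, r, b, s) \<in> ?Q. a = b}"
  have fin: "finite ?G" "finite ?L" "finite ?E"
    by (rule finite_subset[OF _ finite_two_part_solutions[of P n]]; auto)+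
  have "?Q = ?G \<union> (?L \<union> ?E)"
    by auto
  then have "card ?Q = card (?G \<union> (?L \<union> ?E))"
    by simp
  also have "\<dots> = card ?G + card (?L \<union> ?E)"
    using fin by (intro card_Un_disjoint) auto
  also have "card (?L \<union> ?E) = card ?L + card ?E"
    using fin by (intro card_Un_disjoint) auto
  also have "card ?L = card ?G"
    by (rule card_two_part_solutions_swap)
  finally show ?thesis
    using card_two_part_solutions_equal[OF assms, of P] by simp
qed

section \<open>Divisibility by four\<close>

text \<open>
  As \<open>n\<close> is odd, exactly one of \<open>a r\<close> and \<open>b s\<close> is even, so the solutions fall into
  four classes: \<open>a r\<close> is even with \<open>a\<close> odd, \<open>a r\<close> is even with \<open>a\<close> even, and the same
  for \<open>b s\<close>.  Replacing \<open>(a, r)\<close> by \<open>(2 a, r / 2)\<close> maps the first class onto the second,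
  since an allowed even part is twice an odd number.
\<close>

lemma four_dvd_card_two_part_solutions:
  assumes "odd n"
    and not4: "\<And>d. P d \<Longrightarrow> \<not> 4 dvd d"
    and dbl: "\<And>d. odd d \<Longrightarrow> P (2 * d) \<longleftrightarrow> P d"
  shows "4 dvd card (two_part_solutions P n)"
proof -
  let ?Q = "two_part_solutions P n"
  let ?A = "{(a, r, b, s) \<in> ?Q. odd a \<and> even r}" and ?B = "{(a, r, b, s) \<in> ?Q. even a}"
  let ?A' = "{(a, r, b, s) \<in> ?Q. odd b \<and> even s}" and ?B' = "{(a, r, b, s) \<in> ?Q. even b}"
  have fin: "finite ?A" "finite ?B" "finite ?A'" "finite ?B'"
    by (rule finite_subset[OF _ finite_two_part_solutions[of P n]]; auto)+
  have parity: "even (a * r) \<longleftrightarrow> odd (b * s)" if "(a, r, b, s) \<in> ?Q" for a r b s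
    using that assms(1) by (auto simp: two_part_solutions_def)
  have "bij_betw (\<lambda>(a, r, b, s). (2 * a, r div 2, b, s)) ?A ?B"
  proof (rule bij_betw_byWitness[of _ "\<lambda>(a, r, b, s). (a div 2, 2 * r, b, s)"])
    show "(\<lambda>(a, r, b, s). (2 * a, r div 2, b, s)) ` ?A \<subseteq> ?B"
      by (auto simp: two_part_solutions_def dbl elim!: evenE)
    show "(\<lambda>(a, r, b, s). (a div 2, 2 * r, b, s)) ` ?B \<subseteq> ?A"
    proof clarify
      fix a r b s assume B: "(a, r, b, s) \<in> ?Q" "even a"
      then obtain c where c: "a = 2 * c" by (elim evenE)
      with B not4[of a] have "odd c"
        by (auto simp: two_part_solutions_def)
      with B c dbl[of c] show "(a div 2, 2 * r, b, s) \<in> ?Q \<and> odd (a div 2) \<and> even (2 * r)"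
        by (auto simp: two_part_solutions_def)
    qed
  qed auto
  then have AB: "card ?A = card ?B" by (rule bij_betw_same_card)
  have AA': "card ?A = card ?A'" and BB': "card ?B = card ?B'"
    by (rule card_two_part_solutions_swap)+
  have "?Q = (?A \<union> ?B) \<union> (?A' \<union> ?B')"
    using parity by auto
  then have "card ?Q = card ((?A \<union> ?B) \<union> (?A' \<union> ?B'))"
    by simp
  also have "\<dots> = card (?A \<union> ?B) + card (?A' \<union> ?B')"
    using fin parity by (intro card_Un_disjoint) auto
  also have "card (?A \<union> ?B) = card ?A + card ?B"
    using fin by (intro card_Un_disjoint) auto
  also have "card (?A' \<union> ?B') = card ?A' + card ?B'"
    using fin by (intro card_Un_disjoint) auto
  finally have "card ?Q = 4 * card ?A"
    using AB AA' BB' by linarith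
  then show ?thesis by (rule dvdI)
qed

text \<open>
  One pairing of the divisors serves both the count and the sum of the cofactors: \<open>B\<close> holds one
  divisor of each pair and \<open>f\<close> gives its partner.
\<close>

lemma allowed_divisors_paired:
  assumes "n mod 4 = 3"
  defines "D \<equiv> allowed_divisors (\<lambda>d. \<not> 4 dvd d \<and> \<not> 9 dvd d) n"
  obtains B f where "D = B \<union> f ` B" "B \<inter> f ` B = {}" "inj_on f B"
    "\<And>d. d \<in> B \<Longrightarrow> 4 dvd n div d + n div f d"
proof -
  have "n > 0" using assms by presburger
  have "\<not> 4 dvd d" if "d dvd n" for d
  proof
    assume "4 dvd d"
    with that have "4 dvd n" by (rule dvd_trans[rotated])
    with assms(1) show False by presburger
  qed
  then have D: "D = {d. d dvd n \<and> \<not> 9 dvd d}"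
    by (auto simp: D_def allowed_divisors_def)
  show thesis
  proof (cases "3 dvd n")
    case True
    (* The cofactors of d and 3 d are in the ratio 3 : 1, so they add up to 4 n / (3 d). *)
    let ?B = "{d. d dvd n \<and> \<not> 3 dvd d}"
    have "D = ?B \<union> (\<lambda>d. 3 * d) ` ?B"
    proof (intro equalityI subsetI)
      fix d assume d: "d \<in> D"
      show "d \<in> ?B \<union> (\<lambda>d. 3 * d) ` ?B"
      proof (cases "3 dvd d")
        case True
        then obtain e where e: "d = 3 * e" ..
        with d D have "e dvd n" "\<not> 3 dvd e" by (auto dest: dvd_mult_right)
        with e show ?thesis by auto
      qed (use d D in auto)
    next
      fix d assume "d \<in> ?B \<union> (\<lambda>d. 3 * d) ` ?B"
      then show "d \<in> D"
      proof
        assume "d \<in> ?B"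
        moreover have "\<not> 9 dvd d" if "\<not> 3 dvd d"
          using that by presburger
        ultimately show "d \<in> D" by (simp add: D)
      next
        assume "d \<in> (\<lambda>d. 3 * d) ` ?B"
        then obtain e where e: "d = 3 * e" "e dvd n" "\<not> 3 dvd e" by auto
        have "coprime 3 e"
          using e(3) by (auto intro!: prime_imp_coprime simp: prime_nat_numeral_eq)
        then have "3 * e dvd n" using True e(2) by (simp add: divides_mult)
        moreover have "\<not> 9 dvd 3 * e" using e(3) by presburger
        ultimately show "d \<in> D" by (simp add: D e)
      qed
    qed
    moreover have "4 dvd n div d + n div (3 * d)" if "d \<in> ?B" for d
    proof -
      have "3 * d dvd n"
        using that True
        by (auto intro!: divides_mult prime_imp_coprime simp: prime_nat_numeral_eq)
      then obtain k where "n = 3 * d * k" ..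
      moreover from this \<open>n > 0\<close> have "d > 0" by (cases d) auto
      ultimately have "n div d + n div (3 * d) = 4 * k" by simp
      then show ?thesis by simp
    qed
    ultimately show thesis
      by (intro that[of ?B "\<lambda>d. 3 * d"]) (auto simp: inj_on_def)
  next
    case False
    (* A product congruent to 3 modulo 4 has one factor congruent to 1 and one congruent to 3, so
       d and its cofactor are distinct and add up to a multiple of 4. *)
    let ?B = "{d. d dvd n \<and> d mod 4 = 1}"
    have co: "n div d dvd n" "n div (n div d) = d" if "d dvd n" for d
      using that \<open>n > 0\<close> by (auto simp: div_div_eq_right)
    have res: "d mod 4 = 1 \<and> (n div d) mod 4 = 3 \<or> d mod 4 = 3 \<and> (n div d) mod 4 = 1"
      if "d dvd n" for d
    proof -
      from that have "d * (n div d) = n" by simp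
      then have "((d mod 4) * ((n div d) mod 4)) mod 4 = 3"
        using assms(1) by (metis mod_mult_eq)
      moreover have "d mod 4 \<in> {0,1,2,3}" "(n div d) mod 4 \<in> {0,1,2,3}" by auto
      ultimately show ?thesis by auto
    qed
    have "D = {d. d dvd n}"
    proof -
      have "\<not> 9 dvd d" if "d dvd n" for d
        using that False dvd_trans[of 3 9 n] dvd_trans[of 9 d n] by auto
      then show ?thesis by (auto simp: D)
    qed
    also have "\<dots> = ?B \<union> (\<lambda>d. n div d) ` ?B"
    proof (intro equalityI subsetI)
      fix d assume "d \<in> {d. d dvd n}"
      then show "d \<in> ?B \<union> (\<lambda>d. n div d) ` ?B"
        using res[of d] co[of d] by (auto intro!: image_eqI[of _ _ "n div d"])
    qed (use co in auto)
    finally have "D = ?B \<union> (\<lambda>d. n div d) ` ?B" .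
    moreover have "?B \<inter> (\<lambda>d. n div d) ` ?B = {}"
    proof (rule ccontr)
      assume "?B \<inter> (\<lambda>d. n div d) ` ?B \<noteq> {}"
      then obtain d where "d dvd n" "d mod 4 = 1" "(n div d) mod 4 = 1" by auto
      with res[of d] show False by auto
    qed
    moreover have "inj_on (\<lambda>d. n div d) ?B"
      by (rule inj_on_inverseI[of _ "\<lambda>d. n div d"]) (simp add: co)
    moreover have "4 dvd n div d + n div (n div d)" if "d \<in> ?B" for d
    proof -
      have "d dvd n" "d mod 4 = 1" using that by auto
      with res[of d] co(2)[of d] have "n div (n div d) mod 4 = 1" "(n div d) mod 4 = 3"
        by auto
      moreover have "4 dvd v + u" if "u mod 4 = 1" "v mod 4 = 3" for u v :: nat
        using that by presburger
      ultimately show ?thesis by blast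
    qed
    ultimately show thesis by (rule that)
  qed
qed

lemma even_number_of_divisors_and_four_dvd_cofactor_sum:
  assumes "n mod 4 = 3"
  defines "D \<equiv> allowed_divisors (\<lambda>d. \<not> 4 dvd d \<and> \<not> 9 dvd d) n"
  shows "even (card D)" and "4 dvd (\<Sum>d \<in> D. n div d)"
proof -
  have "n > 0" using assms by presburger
  then have "finite D" by (simp add: D_def finite_allowed_divisors)
  obtain B f where B: "D = B \<union> f ` B" "B \<inter> f ` B = {}" "inj_on f B"
    and four: "\<And>d. d \<in> B \<Longrightarrow> 4 dvd n div d + n div f d"
    using allowed_divisors_paired[OF assms(1)] unfolding D_def by blast
  have "finite B" using B(1) \<open>finite D\<close> by simp
  have pair: "sum h D = (\<Sum>d \<in> B. h d + h (f d))" for h :: "nat \<Rightarrow> nat"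
    using B \<open>finite B\<close> by (simp add: sum.union_disjoint sum.reindex sum.distrib)
  show "4 dvd (\<Sum>d \<in> D. n div d)"
    unfolding pair using four by (rule dvd_sum)
  show "even (card D)"
    using pair[of "\<lambda>_. 1"] by simp
qed

theorem theorem5p1:
  fixes n :: nat
  shows "[R_bar 4 9 (12 * n + 3) = 0] (mod 8) \<and>
         [R_bar 4 9 (12 * n + 7) = 0] (mod 8) \<and>
         [R_bar 4 9 (12 * n + 11) = 0] (mod 8)"
proof -
  have "[R_bar 4 9 N = 0] (mod 8)" if N: "N mod 4 = 3" for N
  proof -
    let ?P = "\<lambda>d :: nat. \<not> 4 dvd d \<and> \<not> 9 dvd d"
    let ?N1 = "card (allowed_divisors ?P N)"
    let ?N2 = "card {(a, r, b, s) \<in> two_part_solutions ?P N. b < a}"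
    have "0 < N" "odd N" using N by presburger+
    have "?P (2 * d) \<longleftrightarrow> ?P d" if "odd d" for d
      using that by presburger
    then have "4 dvd card (two_part_solutions ?P N)"
      using \<open>odd N\<close> by (intro four_dvd_card_two_part_solutions) auto
    moreover have "even ?N1" "4 dvd (\<Sum>d \<in> allowed_divisors ?P N. N div d)"
      using even_number_of_divisors_and_four_dvd_cofactor_sum[OF N] by auto
    ultimately have "4 dvd ?N1 + 2 * ?N2"
      using card_two_part_solutions_by_order[OF \<open>0 < N\<close>, of ?P] by presburger
    then have "8 dvd 2 * ?N1 + 4 * ?N2" by presburger
    then show ?thesis
      using overpartition_count_mod_8[OF \<open>0 < N\<close>, of ?P]
      by (simp add: R_bar_def cong_def mod_eq_0_iff_dvd)
  qed
  moreover have "(12 * n + 3) mod 4 = 3" "(12 * n + 7) mod 4 = 3" "(12 * n + 11) mod 4 = 3"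
    by presburger+
  ultimately show ?thesis by blast
qed

end
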